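(* Let $m\geq2$ and let $p(z)=\sum_{k=0}^{m-1}a_kz^k$, $a_k\in\mathbb{C}$, be an analytic polynomial such that $p(0)\geq0$ and $\mathrm{Re}\,p(z)\leq1$ for all $z\in\mathbb{D}$. Then $$|a_k|\leq 2(1-a_0)\cos\frac{\pi}{\left[\frac{m-1}{k}\right]+2}\quad\text{for }1\leq k\leq m-1,$$ and $$\sum_{k=0}^{m-1}|a_k|r^k\leq1\quad\text{for }0\leq r\leq t_m,$$ where $t_m\in(0,1]$ is the solution of the equation $$\sum_{k=1}^{m-1}t^k\cos\frac{\pi}{\left[\frac{m-1}{k}\right]+2}=\frac12.$$
   Context: $\mathbb{D}$ is the open unit disc in $\mathbb{C}$; $[x]$ denotes the integer part of $x$. *)

theory Defs
  imports "HOL-Analysis.Analysis"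
begin

end

theory Submission
  imports Defs
begin

text \<open>
  The polynomial \<open>q = 1 - p\<close> has nonnegative real part on the closed disc, so the coefficient bound
  is the Egervary--Szasz inequality. It follows from a quadrature formula: with \<open>n = m - 1\<close>, \<open>M = n div k + 2\<close>
  and \<open>L = k * M\<close>, averaging over the solutions \<open>z\<close> of \<open>z ^ L = -1\<close> is exact for trigonometric
  polynomials of degree below \<open>L\<close>, in particular for \<open>Re (q z) * (cos (pi / M) - Re (z ^ k))\<close>,
  whose degree is at most \<open>n + k < L\<close>. At the nodes \<open>z ^ k\<close> is an \<open>M\<close>-th root of \<open>-1\<close>, so the second
  factor is nonnegative there, although it changes sign on the circle. The second claim is then
  a comparison of power series, since \<open>norm (a 0) = Re (a 0)\<close>.
\<close>

section \<open>Quadrature nodes: the roots of -1\<close>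

text \<open>Up to a constant phase this is a geometric sum whose ratio \<open>x\<close> is an
  \<open>L\<close>-th root of unity, different from 1 because \<open>L\<close> does not divide
  \<open>l\<close>.\<close>

lemma sum_cis_odd_nodes:
  fixes l :: int and L :: nat
  assumes "l \<noteq> 0" "\<bar>l\<bar> < int L"
  shows "(\<Sum>j<L. cis (of_int l * (real (2 * j + 1) * pi / real L))) = 0"
proof -
  have L: "real L > 0" using assms by linarith
  define x where "x = cis (2 * pi * (of_int l / real L))"
  have "x \<noteq> 1"
  proof
    assume "x = 1"
    then have "cos (2 * pi * (of_int l / real L)) = 1"
      unfolding x_def by (metis cis.sel(1) one_complex.sel(1))
    then obtain i :: int where "2 * pi * (of_int l / real L) = of_int i * 2 * pi"
      using cos_one_2pi_int by blast
    then have "of_int l = (of_int (i * int L) :: real)"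
      using L by (simp add: field_simps)
    then have "l = i * int L"
      by linarith
    then show False
      using assms by (metis dvd_triv_right zdvd_not_zless zero_less_abs_iff dvd_abs_iff)
  qed
  moreover have "x ^ L = cis (2 * pi * of_int l)"
    using L by (simp add: x_def Complex.DeMoivre)
  then have "x ^ L = 1"
    by (simp add: cis_multiple_2pi)
  ultimately have "(\<Sum>j<L. x ^ j) = 0"
    by (simp add: sum_gp_strict)
  moreover have "cis (of_int l * (real (2 * j + 1) * pi / real L))
      = cis (of_int l * pi / real L) * x ^ j" for j
    by (simp add: x_def Complex.DeMoivre cis_mult add_divide_distrib algebra_simps)
  ultimately show ?thesis
    by (simp flip: sum_distrib_left)
qed

text \<open>An odd multiple of \<open>pi / M\<close> stays at distance at least
  \<open>pi / M\<close> from every multiple of \<open>2 * pi\<close>, and the cosine decreases with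
  that distance up to \<open>pi\<close>.\<close>

lemma cos_odd_multiple_le:
  fixes j M :: nat
  assumes "M > 0"
  shows "cos (real (2 * j + 1) * pi / real M) \<le> cos (pi / real M)"
proof -
  define s where "s = j mod M"
  define y where "y = real (2 * s + 1) * pi / real M"
  have s: "s < M" using assms by (simp add: s_def)
  have "real j = real (M * (j div M) + s)"
    unfolding s_def by simp
  then have "real (2 * j + 1) * pi / real M = y + 2 * real (j div M) * pi"
    using assms unfolding y_def by (simp add: field_simps)
  then have cosy: "cos (real (2 * j + 1) * pi / real M) = cos y"
    by (simp only: cos_add) simp
  have low: "pi / real M \<le> y"
    unfolding y_def by (intro divide_right_mono) auto
  have "y + pi / real M = real (2 * s + 2) * pi / real M"
    unfolding y_def by (simp add: add_divide_distrib algebra_simps)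
  also have "\<dots> \<le> real (2 * M) * pi / real M"
    using s by (intro divide_right_mono mult_right_mono) auto
  also have "\<dots> = 2 * pi"
    using assms by simp
  finally have high: "pi / real M \<le> 2 * pi - y" by simp
  have pos: "0 \<le> pi / real M" by simp
  show ?thesis
  proof (cases "y \<le> pi")
    case True
    then show ?thesis using cosy low pos by (simp add: cos_monotone_0_pi_le)
  next
    \<comment> \<open>Past \<open>pi\<close>, the reflection to \<open>2 * pi - y\<close> keeps the
      cosine and returns to the range where it decreases.\<close>
    case False
    then have "cos (2 * pi - y) \<le> cos (pi / real M)"
      using high pos by (intro cos_monotone_0_pi_le) auto
    then show ?thesis using cosy by (simp add: cos_diff)
  qed
qed

section \<open>The Egervary-Szasz inequality\<close>

lemma Egervary_Szasz_Re:
  fixes b :: "nat \<Rightarrow> complex" and n k :: nat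
  assumes k: "k \<in> {1..n}"
    and nonneg: "\<And>\<theta>. 0 \<le> Re (\<Sum>i\<le>n. b i * cis \<theta> ^ i)"
  shows "Re (b k) \<le> 2 * Re (b 0) * cos (pi / real (n div k + 2))"
proof -
  define M where "M = n div k + 2"
  define L where "L = k * M"
  define c where "c = cos (pi / real M)"
  define \<theta> where "\<theta> j = real (2 * j + 1) * pi / real L" for j
  define e where "e l = (\<Sum>j<L. cis (of_int l * \<theta> j))" for l :: int
  have kpos: "k > 0" and kn: "k \<le> n" using k by auto
  \<comment> \<open>The remainder of \<open>n\<close> modulo \<open>k\<close> is below
    \<open>k\<close>. Hence \<open>M\<close> is the least integer with \<open>n + k < k * M\<close>,
    which is what exactness of the quadrature requires.\<close>
  have "n < k * (n div k) + k"
    using kpos by (metis add_less_cancel_left mod_less_divisor mult_div_mod_eq)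
  then have nL: "n + k < L"
    by (simp add: L_def M_def algebra_simps)
  have M: "M > 0" by (simp add: M_def)
  have e0: "e 0 = of_nat L"
    by (simp add: e_def)
  have e_vanish: "e l = 0" if "l \<noteq> 0" "\<bar>l\<bar> < int L" for l
    unfolding e_def \<theta>_def using sum_cis_odd_nodes[OF that] .
  \<comment> \<open>Product-to-sum splits each term into the pure frequencies \<open>i\<close>,
    \<open>i + k\<close> and \<open>i - k\<close>. The last may be negative, hence the integer
    argument of \<open>e\<close>.\<close>
  have summand: "Re (\<Sum>i\<le>n. b i * cis (\<theta> j) ^ i) * (c - cos (real k * \<theta> j))
      = Re (\<Sum>i\<le>n. b i * (of_real c * cis (of_int (int i) * \<theta> j)
          - (cis (of_int (int i + int k) * \<theta> j) + cis (of_int (int i - int k) * \<theta> j)) / 2))" for j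
  proof -
    have "cis (of_int (int i + int k) * \<theta> j) + cis (of_int (int i - int k) * \<theta> j)
        = 2 * of_real (cos (real k * \<theta> j)) * cis (of_int (int i) * \<theta> j)" for i
      by (simp add: complex_eq_iff algebra_simps cos_add sin_add cos_diff sin_diff)
    then have "(\<Sum>i\<le>n. b i * (of_real c * cis (of_int (int i) * \<theta> j)
          - (cis (of_int (int i + int k) * \<theta> j) + cis (of_int (int i - int k) * \<theta> j)) / 2))
        = of_real (c - cos (real k * \<theta> j)) * (\<Sum>i\<le>n. b i * cis (\<theta> j) ^ i)"
      by (simp add: sum_distrib_left Complex.DeMoivre algebra_simps)
    then show ?thesis by simp
  qed
  have "0 \<le> (\<Sum>j<L. Re (\<Sum>i\<le>n. b i * cis (\<theta> j) ^ i) * (c - cos (real k * \<theta> j)))"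
  proof (intro sum_nonneg mult_nonneg_nonneg nonneg)
    fix j
    have "real k * \<theta> j = real (2 * j + 1) * pi / real M"
      using kpos by (simp add: \<theta>_def L_def)
    then show "0 \<le> c - cos (real k * \<theta> j)"
      using cos_odd_multiple_le[OF M, of j] by (simp add: c_def)
  qed
  also have "\<dots> = Re (\<Sum>j<L. \<Sum>i\<le>n. b i * (of_real c * cis (of_int (int i) * \<theta> j)
          - (cis (of_int (int i + int k) * \<theta> j) + cis (of_int (int i - int k) * \<theta> j)) / 2))"
    by (subst Re_sum) (simp only: summand)
  also have "(\<Sum>j<L. \<Sum>i\<le>n. b i * (of_real c * cis (of_int (int i) * \<theta> j)
          - (cis (of_int (int i + int k) * \<theta> j) + cis (of_int (int i - int k) * \<theta> j)) / 2))
      = (\<Sum>i\<le>n. b i * (of_real c * e (int i) - (e (int i + int k) + e (int i - int k)) / 2))"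
    unfolding e_def
    by (subst sum.swap) (simp only: sum_subtractf sum.distrib flip: sum_distrib_left sum_divide_distrib)
  also have "\<dots> = (\<Sum>i\<le>n. (if i = 0 then b 0 * of_real c * of_nat L else 0)
      - (if i = k then b k * of_nat L / 2 else 0))"
  proof (rule sum.cong[OF refl])
    fix i assume "i \<in> {..n}"
    then have i: "i \<le> n" by simp
    \<comment> \<open>Only frequency zero survives averaging: it occurs for \<open>i = 0\<close> in
      the first term and for \<open>i = k\<close> in the difference, never in
      \<open>i + k\<close>.\<close>
    have e1: "e (int i) = (if i = 0 then of_nat L else 0)"
      using e0 nL i by (auto intro: e_vanish)
    have e2: "e (int i + int k) = 0"
      using nL i kpos by (intro e_vanish) auto
    have e3: "e (int i - int k) = (if i = k then of_nat L else 0)"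
      using e0 nL i by (auto intro: e_vanish)
    show "b i * (of_real c * e (int i) - (e (int i + int k) + e (int i - int k)) / 2)
      = (if i = 0 then b 0 * of_real c * of_nat L else 0)
      - (if i = k then b k * of_nat L / 2 else 0)"
      unfolding e1 e2 e3 using kpos by auto
  qed
  also have "\<dots> = b 0 * of_real c * of_nat L - b k * of_nat L / 2"
    using kn by (simp add: sum_subtractf)
  finally have "0 \<le> real L * (2 * Re (b 0) * c - Re (b k))"
    by (simp add: algebra_simps)
  then have "0 \<le> 2 * Re (b 0) * c - Re (b k)"
    using nL by (simp add: zero_le_mult_iff)
  then show ?thesis
    by (simp add: c_def M_def)
qed

text \<open>Rotating the variable by \<open>\<phi>\<close> maps the circle to itself and fixes
  \<open>b 0\<close>, while it turns the coefficient of index \<open>k\<close> into its modulus; the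
  bound on real parts then applies.\<close>

theorem Egervary_Szasz:
  fixes b :: "nat \<Rightarrow> complex" and n k :: nat
  assumes k: "k \<in> {1..n}"
    and nonneg: "\<And>z. norm z = 1 \<Longrightarrow> 0 \<le> Re (\<Sum>i\<le>n. b i * z ^ i)"
  shows "norm (b k) \<le> 2 * Re (b 0) * cos (pi / real (n div k + 2))"
proof -
  define \<phi> where "\<phi> = - Arg (b k) / real k"
  have "Re (b k * cis \<phi> ^ k) \<le> 2 * Re (b 0 * cis \<phi> ^ 0) * cos (pi / real (n div k + 2))"
  proof (rule Egervary_Szasz_Re[OF k])
    fix \<theta>
    show "0 \<le> Re (\<Sum>i\<le>n. b i * cis \<phi> ^ i * cis \<theta> ^ i)"
      using nonneg[of "cis \<phi> * cis \<theta>"]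
      by (simp add: norm_mult power_mult_distrib mult.assoc)
  qed
  moreover have "b k * cis \<phi> ^ k = of_real (norm (b k))"
  proof -
    have "b k = of_real (norm (b k)) * cis (Arg (b k))"
      by (metis rcis_cmod_Arg rcis_def)
    moreover have "cis \<phi> ^ k = cis (- Arg (b k))"
      using k by (auto simp: \<phi>_def Complex.DeMoivre)
    ultimately show ?thesis
      by (metis cis_mult cis_zero add.right_inverse mult.assoc mult.right_neutral)
  qed
  ultimately show ?thesis by simp
qed

section \<open>Boundary values and the radius\<close>

text \<open>Bridges the hypothesis on \<open>p\<close>, given in the open disc, and the nodes, which
  lie on the circle.\<close>

lemma continuous_le_on_unit_circle:
  fixes f :: "complex \<Rightarrow> real"
  assumes "continuous_on UNIV f" "\<And>z. z \<in> ball 0 1 \<Longrightarrow> f z \<le> B" "norm z = 1"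
  shows "f z \<le> B"
proof (rule continuous_le_on_closure[where f = f and S = "ball 0 1"])
  show "continuous_on (closure (ball 0 1)) f"
    using assms(1) continuous_on_subset by blast
  show "z \<in> closure (ball 0 1)"
    using assms(3) by simp
  show "f w \<le> B" if "w \<in> ball 0 1" for w
    using assms(2) that .
qed

lemma half_le_cos_pi_div:
  fixes M :: nat
  assumes "M \<ge> 3"
  shows "1 / 2 \<le> cos (pi / real M)"
proof -
  have "pi / real M \<le> pi / 3"
    using assms by (intro divide_left_mono) auto
  then have "cos (pi / 3) \<le> cos (pi / real M)"
    using assms by (intro cos_monotone_0_pi_le) auto
  then show ?thesis by (simp add: cos_60)
qed

text \<open>The sum vanishes at 0, reaches at least \<open>y\<close> at 1 and increases strictly, so
  the intermediate value theorem gives the root and monotonicity its uniqueness.\<close>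

lemma ex1_root_of_pos_power_sum:
  fixes c :: "nat \<Rightarrow> real"
  assumes "n \<ge> 1" "\<And>k. k \<in> {1..n} \<Longrightarrow> c k > 0" "y > 0" "y \<le> (\<Sum>k=1..n. c k)"
  shows "\<exists>!t. t \<in> {0<..1} \<and> (\<Sum>k=1..n. t ^ k * c k) = y"
proof -
  define g where "g t = (\<Sum>k=1..n. t ^ k * c k)" for t
  have mono: "g s < g t" if "0 \<le> s" "s < t" for s t
    unfolding g_def
    using assms(1,2) that
    by (intro sum_strict_mono mult_strict_right_mono power_strict_mono) auto
  have g0: "g 0 = 0"
    unfolding g_def by (intro sum.neutral) auto
  have "continuous_on {0..1} g"
    unfolding g_def by (intro continuous_intros)
  then obtain t where t: "0 \<le> t" "t \<le> 1" "g t = y"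
    using IVT'[of g 0 y 1] g0 assms(3,4) by (auto simp: g_def)
  moreover have "t \<noteq> 0" using t g0 assms(3) by auto
  ultimately have "t \<in> {0<..1} \<and> g t = y" by auto
  moreover have "s = t" if "s \<in> {0<..1} \<and> g s = y" for s
    using mono[of s t] mono[of t s] that t by (cases s t rule: linorder_cases) auto
  ultimately show ?thesis
    unfolding g_def by blast
qed

theorem corollary1p3:
  fixes m :: nat and a :: "nat \<Rightarrow> complex" and p :: "complex \<Rightarrow> complex"
  assumes "m \<ge> 2"
    and "\<And>z. p z = (\<Sum>k=0..m-1. a k * z ^ k)"
    and "p 0 \<in> \<real>\<^sub>\<ge>\<^sub>0"
    and "\<And>z. z \<in> ball 0 1 \<Longrightarrow> Re (p z) \<le> 1"
  shows "(\<forall>k\<in>{1..m-1}. norm (a k) \<le> 2 * (1 - Re (a 0)) * cos (pi / real ((m - 1) div k + 2)))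
    \<and> (\<exists>!t::real. t \<in> {0<..1} \<and> (\<Sum>k=1..m-1. t ^ k * cos (pi / real ((m - 1) div k + 2))) = 1 / 2)
    \<and> (\<forall>t\<^sub>m::real. t\<^sub>m \<in> {0<..1} \<and> (\<Sum>k=1..m-1. t\<^sub>m ^ k * cos (pi / real ((m - 1) div k + 2))) = 1 / 2
          \<longrightarrow> (\<forall>r\<in>{0..t\<^sub>m}. (\<Sum>k=0..m-1. norm (a k) * r ^ k) \<le> 1))"
proof -
  define n where "n = m - 1"
  define c where "c k = cos (pi / real (n div k + 2))" for k
  have n: "n \<ge> 1" using assms(1) by (simp add: n_def)
  have p: "p z = (\<Sum>k\<le>n. a k * z ^ k)" for z
    using assms(2) by (simp add: n_def atMost_atLeast0)
  have "p 0 = a 0"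
    by (simp add: p power_0_left if_distrib cong: if_cong)
  then have a0: "a 0 \<in> \<real>\<^sub>\<ge>\<^sub>0" and a0_le: "Re (a 0) \<le> 1"
    using assms(3) assms(4)[of 0] by auto
  then have norm_a0: "norm (a 0) = Re (a 0)"
    by (auto elim!: nonneg_Reals_cases)
  have circle: "Re (p z) \<le> 1" if "norm z = 1" for z
  proof (rule continuous_le_on_unit_circle[where f = "\<lambda>z. Re (p z)", OF _ assms(4) that])
    show "continuous_on UNIV (\<lambda>z. Re (p z))"
      unfolding p by (intro continuous_intros)
  qed
  have bound: "norm (a k) \<le> 2 * (1 - Re (a 0)) * c k" if k: "k \<in> {1..n}" for k
  proof -
    \<comment> \<open>These are the coefficients of \<open>1 - p\<close>:
      \<open>b 0 = 1 - a 0\<close>, and \<open>b k = - a k\<close> has the modulus of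
      \<open>a k\<close> for positive \<open>k\<close>.\<close>
    define b where "b i = (if i = 0 then 1 else 0) - a i" for i
    have "(\<Sum>i\<le>n. b i * z ^ i) = 1 - p z" for z
      by (simp add: b_def p left_diff_distrib sum_subtractf if_distrib[of "\<lambda>x. x * _"] cong: if_cong)
    then have "norm (b k) \<le> 2 * Re (b 0) * cos (pi / real (n div k + 2))"
      using circle by (intro Egervary_Szasz[OF k]) simp
    then show ?thesis
      using k by (simp add: b_def c_def)
  qed
  have c_half: "1 / 2 \<le> c k" if "k \<in> {1..n}" for k
  proof -
    have "n div k > 0" using that by (auto simp: div_greater_zero_iff)
    then show ?thesis unfolding c_def by (intro half_le_cos_pi_div) simp
  qed
  have c_pos: "c k > 0" if "k \<in> {1..n}" for k
    using c_half[OF that] by linarith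
  \<comment> \<open>The term \<open>c 1\<close> alone reaches \<open>1 / 2\<close>, as its angle is
    \<open>pi / (n + 2)\<close> with \<open>n + 2\<close> at least 3; so the root lies in the unit
    interval.\<close>
  have "c 1 \<le> (\<Sum>k=1..n. c k)"
    using n c_pos by (intro member_le_sum) (auto intro: less_imp_le)
  then have "1 / 2 \<le> (\<Sum>k=1..n. c k)"
    using c_half[of 1] n by simp
  then have root: "\<exists>!t. t \<in> {0<..1} \<and> (\<Sum>k=1..n. t ^ k * c k) = 1 / 2"
    using n c_pos by (intro ex1_root_of_pos_power_sum) auto
  have sum_le: "(\<Sum>k=0..n. norm (a k) * r ^ k) \<le> 1"
    if t: "(\<Sum>k=1..n. t ^ k * c k) = 1 / 2" and r: "r \<in> {0..t}" for t r
  proof -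
    have "(\<Sum>k=1..n. norm (a k) * r ^ k) \<le> (\<Sum>k=1..n. 2 * (1 - Re (a 0)) * (t ^ k * c k))"
    proof (rule sum_mono)
      fix k assume k: "k \<in> {1..n}"
      have "norm (a k) * r ^ k \<le> (2 * (1 - Re (a 0)) * c k) * t ^ k"
        using bound[OF k] c_pos[OF k] a0_le r by (intro mult_mono power_mono) auto
      then show "norm (a k) * r ^ k \<le> 2 * (1 - Re (a 0)) * (t ^ k * c k)"
        by (simp add: mult_ac)
    qed
    \<comment> \<open>The equation for \<open>t\<close> cancels the factor 2; adding the constant
      term, equal to \<open>Re (a 0)\<close>, gives exactly 1.\<close>
    also have "\<dots> = 1 - Re (a 0)"
      by (simp only: sum_distrib_left[symmetric] t) simp
    finally show ?thesis
      by (simp add: sum.atLeast_Suc_atMost norm_a0)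
  qed
  show ?thesis
    using bound root sum_le unfolding c_def n_def by blast
qed

end
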